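(* The function $\xi_{\mathbb Q}(w,s)=\frac{s(s-w)}{2w}Z_{\mathbb Q}(w,s)$ analytically continues to an entire function on $\mathbb C^2$, and satisfies the functional equation $\xi_{\mathbb Q}(w,s)=\xi_{\mathbb Q}(w,w-s)$.
   Context: Let $\theta(t)=\sum_{n\in\mathbb Z}e^{-\pi n^2 t}$ for $t>0$. For $(w,s)\in\mathbb C^2$ with $\Re(w)<\Re(s)<0$, define $Z_{\mathbb Q}(w,s)=\int_0^\infty\theta(t^2)^s\theta(1/t^2)^{w-s}\frac{dt}{t}$, which converges absolutely and defines an analytic function on that region; the statement concerns the analytic continuation of $\frac{s(s-w)}{2w}Z_{\mathbb Q}(w,s)$ from this region. *)

theory Defs
  imports "HOL-Analysis.Analysis"
begin

definition theta :: "real \<Rightarrow> real" where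
  "theta t = (\<Sum>\<^sub>\<infinity>n::int. exp (- pi * (of_int n)\<^sup>2 * t))"

(* For t > 0 the bases below are positive reals, so the principal branch used by
   powr is the usual power x^z = exp (z * ln x). *)
definition Z_Q :: "complex \<Rightarrow> complex \<Rightarrow> complex" where
  "Z_Q w s = (LBINT t:{0<..}.
     complex_of_real (theta (t\<^sup>2)) powr s * complex_of_real (theta (1 / t\<^sup>2)) powr (w - s)
       / complex_of_real t)"

(* Meaningful on xi_region only, where the integral Z_Q converges absolutely. *)
definition xi_Q :: "complex \<Rightarrow> complex \<Rightarrow> complex" where
  "xi_Q w s = s * (s - w) / (2 * w) * Z_Q w s"

definition xi_region :: "(complex \<times> complex) set" where
  "xi_region = {(w, s). Re w < Re s \<and> Re s < 0}"

(* The library's holomorphic_on only covers functions of one complex variable.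
   Here: at every point of C^2 there is a Frechet derivative that is complex linear. *)
definition entire2 :: "(complex \<times> complex \<Rightarrow> complex) \<Rightarrow> bool" where
  "entire2 F \<longleftrightarrow>
     (\<forall>z. \<exists>a b. (F has_derivative (\<lambda>(h, k). a * h + b * k)) (at z))"

end

theory Submission
  imports Defs "HOL-Real_Asymp.Real_Asymp"
begin

text \<open>
  Put \<open>L x = ln (theta (exp (2 * x)))\<close>. The substitution \<open>t = exp x\<close> and Jacobi's functional equation,
  which reads \<open>L (- x) = x + L x\<close>, turn \<open>Z_Q w s\<close> into the integral of
  \<open>exp (w * L x) * (exp (s * x) + exp ((w - s) * x))\<close> over \<open>x > 0\<close>. Subtracting the value 1 of
  \<open>exp (w * L x)\<close> at infinity splits off the poles \<open>- 1 / s - 1 / (w - s)\<close>. The remainder is divisible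
  by \<open>w\<close>: since \<open>(exp (w * l) - 1) / w\<close> is the integral of \<open>exp (w * u)\<close> over \<open>0 < u < l\<close>, the quotient
  is the Laplace transform in two variables of the region \<open>0 < u < L x\<close>, \<open>0 < x\<close>, and it is entire
  because \<open>L x\<close> decays faster than any exponential.

  Jacobi's equation is obtained by Polya's elementary method: averaging \<open>(2 * cos (pi * l / n)) ^ (2 * m)\<close>
  over \<open>l\<close> modulo \<open>n\<close> gives the sum of the binomial coefficients \<open>2 * m choose (m + n * j)\<close>, and both
  sides converge to theta series when \<open>m / n\<^sup>2\<close> tends to \<open>y / pi\<close>.
\<close>

subsection \<open>Polya's trigonometric identity\<close>

text \<open>The sum is the real part of a geometric sum over powers of the n-th root of unity
  \<open>z = cis (2 * pi * d / n)\<close>, which equals 1 exactly when n divides d. This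
  orthogonality picks out a residue class of frequencies.\<close>

lemma sum_cos_roots:
  fixes d :: int
  assumes "n > 0"
  shows "(\<Sum>l<n. cos (2 * pi * real l * of_int d / real n)) = (if int n dvd d then real n else 0)"
proof (cases "int n dvd d")
  case True
  then obtain q where q: "d = int n * q" by auto
  have "cos (2 * pi * real l * of_int d / real n) = 1" for l
  proof -
    have "2 * pi * real l * of_int d / real n = 2 * pi * of_int (int l * q)"
      using assms by (simp add: q)
    then show ?thesis
      by (metis cos_int_2pin)
  qed
  then show ?thesis using True by simp
next
  case False
  define z where "z = cis (2 * pi * of_int d / real n)"
  have zn: "z ^ n = 1"
  proof -
    have "z ^ n = cis (real n * (2 * pi * of_int d / real n))"
      unfolding z_def by (rule Complex.DeMoivre)
    also have "real n * (2 * pi * of_int d / real n) = 2 * pi * of_int d"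
      using assms by simp
    also have "cis \<dots> = 1"
      by (simp add: cis_multiple_2pi)
    finally show ?thesis .
  qed
  have z1: "z \<noteq> 1"
  proof
    assume "z = 1"
    then have "cos (2 * pi * of_int d / real n) = 1"
      unfolding z_def by (metis cis.sel(1) one_complex.sel(1))
    then obtain x :: int where "2 * pi * of_int d / real n = of_int x * 2 * pi"
      using cos_one_2pi_int by auto
    then have "of_int d = (of_int (x * int n) :: real)"
      using assms by (simp add: field_simps)
    then have "d = x * int n" by (simp only: of_int_eq_iff)
    then show False using False by simp
  qed
  have "(\<Sum>l<n. z ^ l) = 0"
    using z1 zn by (simp add: geometric_sum)
  then have "Re (\<Sum>l<n. z ^ l) = 0" by simp
  moreover have "Re (z ^ l) = cos (2 * pi * real l * of_int d / real n)" for l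
    unfolding z_def by (simp add: Complex.DeMoivre mult_ac)
  ultimately show ?thesis using False by simp
qed

text \<open>Binomial expansion of \<open>(cis x + cis (- x)) ^ (2 * m)\<close>: the k-th term
  carries the frequency k - (2m - k) = 2(k - m). Real parts give the claim.\<close>

lemma cos_power_even:
  "(2 * cos x) ^ (2 * m) = (\<Sum>k\<le>2*m. real (2 * m choose k) * cos (2 * x * of_int (int k - int m)))"
proof -
  have "complex_of_real ((2 * cos x) ^ (2 * m)) = (cis x + cis (- x)) ^ (2 * m)"
  proof -
    have "complex_of_real (2 * cos x) = cis x + cis (- x)"
      by (simp add: complex_eq_iff)
    then show ?thesis by (metis of_real_power)
  qed
  also have "\<dots> = (\<Sum>k\<le>2*m. of_nat (2 * m choose k) * cis x ^ k * cis (- x) ^ (2 * m - k))"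
    by (rule binomial_ring)
  also have "\<dots> = (\<Sum>k\<le>2*m. of_nat (2 * m choose k) * cis (2 * x * of_int (int k - int m)))"
  proof (rule sum.cong)
    fix k assume "k \<in> {..2*m}"
    then have "cis x ^ k * cis (- x) ^ (2 * m - k) = cis (2 * x * of_int (int k - int m))"
      by (simp add: Complex.DeMoivre cis_mult of_nat_diff algebra_simps)
    then show "of_nat (2 * m choose k) * cis x ^ k * cis (- x) ^ (2 * m - k) =
        of_nat (2 * m choose k) * cis (2 * x * of_int (int k - int m))"
      by (simp add: mult.assoc)
  qed simp
  finally have "Re (complex_of_real ((2 * cos x) ^ (2 * m))) =
      Re (\<Sum>k\<le>2*m. of_nat (2 * m choose k) * cis (2 * x * of_int (int k - int m)))"
    by simp
  then show ?thesis by simp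
qed

text \<open>The symmetry of the binomial coefficients folds the indices below the centre m onto
  those above it, where the surviving indices are m + n * j. Letting j run up to m adds only
  coefficients with m + n * j > 2 * m, which are 0.\<close>

lemma sum_binomial_progression:
  assumes "n > 0"
  shows "(\<Sum>k\<le>2*m. if int n dvd int k - int m then real (2 * m choose k) else 0) =
    real (2 * m choose m) + 2 * (\<Sum>j\<in>{1..m}. real (2 * m choose (m + n * j)))"
proof -
  let ?f = "\<lambda>k. if int n dvd int k - int m then real (2 * m choose k) else 0"
  let ?h = "\<lambda>d. if n dvd d then real (2 * m choose (m + d)) else 0"
  have split: "{..2*m} = {..<m} \<union> {m} \<union> {m<..2*m}" by auto
  have "sum ?f {..2*m} = sum ?f {..<m} + ?f m + sum ?f {m<..2*m}"
    unfolding split by (subst sum.union_disjoint; auto)+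
  also have "sum ?f {m<..2*m} = sum ?h {1..m}"
    by (rule sum.reindex_bij_witness[of _ "\<lambda>d. m + d" "\<lambda>k. k - m"])
       (auto simp: of_nat_diff simp flip: int_dvd_int_iff)
  also have "sum ?f {..<m} = sum ?h {1..m}"
  proof (rule sum.reindex_bij_witness[of _ "\<lambda>d. m - d" "\<lambda>k. m - k"])
    fix k assume k: "k \<in> {..<m}"
    have "int n dvd int k - int m \<longleftrightarrow> n dvd m - k"
      using k by (simp add: dvd_diff_commute of_nat_diff flip: int_dvd_int_iff)
    moreover have "2 * m choose k = 2 * m choose (m + (m - k))"
      using k by (subst binomial_symmetric) (auto intro: arg_cong)
    ultimately show "?h (m - k) = ?f k" by simp
  qed auto
  also have "sum ?h {1..m} = (\<Sum>j\<in>{1..m}. real (2 * m choose (m + n * j)))"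
  proof -
    have "sum ?h {1..m} = (\<Sum>d\<in>{d\<in>{1..m}. n dvd d}. real (2 * m choose (m + d)))"
      by (rule sum.inter_filter[symmetric]) simp
    also have "\<dots> = (\<Sum>j\<in>{j\<in>{1..m}. n * j \<le> m}. real (2 * m choose (m + n * j)))"
    proof (rule sum.reindex_bij_witness[of _ "\<lambda>j. n * j" "\<lambda>d. d div n"])
      fix d assume d: "d \<in> {d\<in>{1..m}. n dvd d}"
      then have "d div n \<noteq> 0" by (auto simp: dvd_div_eq_0_iff)
      moreover have "d div n \<le> m"
        using d by (auto intro: order_trans[OF div_le_dividend])
      ultimately show "d div n \<in> {j\<in>{1..m}. n * j \<le> m}" using d by auto
    qed (use assms in \<open>auto simp: Suc_le_eq\<close>)
    also have "\<dots> = (\<Sum>j\<in>{1..m}. real (2 * m choose (m + n * j)))"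
      by (rule sum.mono_neutral_left) auto
    finally show ?thesis .
  qed
  finally show ?thesis by simp
qed

text \<open>The reflection of l to n - l changes only the sign of the cosine, which the even
  exponent absorbs. As n is odd, it exchanges 1..p and p+1..2p without a fixed point. The remaining
  angles lie below pi / 2, where the Gaussian bound \<open>cos_le_gauss\<close> is
  available.\<close>

lemma sum_cos_power_reflect:
  assumes n: "n = 2 * p + 1"
  shows "(\<Sum>l<n. cos (pi * real l / real n) ^ (2 * m)) = 1 + 2 * (\<Sum>l\<in>{1..p}. cos (pi * real l / real n) ^ (2 * m))"
proof -
  let ?f = "\<lambda>l::nat. cos (pi * real l / real n) ^ (2 * m)"
  have split: "{..<n} = {0} \<union> {1..p} \<union> {p<..2*p}" using n by auto
  have "sum ?f {..<n} = ?f 0 + sum ?f {1..p} + sum ?f {p<..2*p}"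
    unfolding split by (subst sum.union_disjoint; auto)+
  also have "sum ?f {p<..2*p} = sum ?f {1..p}"
  proof (rule sum.reindex_bij_witness[of _ "\<lambda>l. n - l" "\<lambda>l. n - l"])
    fix l assume l: "l \<in> {p<..2*p}"
    have "pi * real (n - l) / real n = pi - pi * real l / real n"
      using l n by (simp add: of_nat_diff field_simps)
    then show "?f (n - l) = ?f l" by (simp add: cos_pi_minus)
  qed (use n in auto)
  finally show ?thesis by simp
qed

text \<open>The sum of \<open>(2 * cos (pi * l / n)) ^ (2 * m)\<close> over l < n is computed twice:
  by reflection, and by binomial expansion with orthogonality. Dividing by the central coefficient
  leaves ratios that have Gaussian limits.\<close>

lemma polya_identity:
  assumes n: "n = 2 * p + 1"
  shows "1 + 2 * (\<Sum>l\<in>{1..p}. cos (pi * real l / real n) ^ (2 * m)) =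
    real n * real (2 * m choose m) / 4 ^ m *
      (1 + 2 * (\<Sum>j\<in>{1..m}. real (2 * m choose (m + n * j)) / real (2 * m choose m)))"
proof -
  have n0: "n > 0" using n by simp
  have "4 ^ m * (1 + 2 * (\<Sum>l\<in>{1..p}. cos (pi * real l / real n) ^ (2 * m))) =
      (\<Sum>l<n. (2 * cos (pi * real l / real n)) ^ (2 * m))"
    unfolding sum_cos_power_reflect[OF n, symmetric]
    by (simp add: power_mult_distrib power_mult sum_distrib_left)
  also have "\<dots> = (\<Sum>l<n. \<Sum>k\<le>2*m. real (2 * m choose k) * cos (2 * pi * real l * of_int (int k - int m) / real n))"
    by (simp only: cos_power_even times_divide_eq_left times_divide_eq_right mult.assoc)
  also have "\<dots> = (\<Sum>k\<le>2*m. real (2 * m choose k) * (\<Sum>l<n. cos (2 * pi * real l * of_int (int k - int m) / real n)))"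
    by (subst sum.swap) (simp add: sum_distrib_left)
  also have "\<dots> = real n * (\<Sum>k\<le>2*m. if int n dvd int k - int m then real (2 * m choose k) else 0)"
    unfolding sum_cos_roots[OF n0] sum_distrib_left by (intro sum.cong) auto
  also have "\<dots> = real n * (real (2 * m choose m) + 2 * (\<Sum>j\<in>{1..m}. real (2 * m choose (m + n * j))))"
    unfolding sum_binomial_progression[OF n0] ..
  also have "\<dots> = real n * real (2 * m choose m) *
      (1 + 2 * (\<Sum>j\<in>{1..m}. real (2 * m choose (m + n * j)) / real (2 * m choose m)))"
  proof -
    have "real (2 * m choose m) \<noteq> 0" by simp
    then show ?thesis by (simp add: field_simps flip: sum_divide_distrib)
  qed
  finally show ?thesis by (simp add: field_simps)
qed

section \<open>Gaussian bounds for binomial coefficients near the centre\<close>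

lemma binomial_ratio_Suc:
  "real (2 * m choose (m + Suc k)) = real (2 * m choose (m + k)) * (real (m - k) / real (m + k + 1))"
proof -
  have "(2 * m - (m + k)) * (2 * m choose (m + k)) = Suc (m + k) * (2 * m choose Suc (m + k))"
    by (metis binomial_absorb_comp binomial_absorption mult.commute Suc_diff_diff diff_Suc_1)
  \<comment> \<open>Subtraction is truncated, so for k >= m both sides are 0 and the recursion also
    holds past the last nonzero coefficient.\<close>
  then have "real (m - k) * real (2 * m choose (m + k)) = real (m + k + 1) * real (2 * m choose (m + Suc k))"
    by (metis Suc_eq_plus1 add_Suc_right diff_cancel2 mult_2 diff_diff_left diff_add_inverse of_nat_mult add.commute)
  then show ?thesis by (simp add: field_simps del: of_nat_Suc of_nat_add)
qed

text \<open>The weight of a symmetric binomial distribution at distance k from its centre, relative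
  to the central weight. By de Moivre-Laplace it resembles exp(-k^2 / m).\<close>

definition bratio :: "nat \<Rightarrow> nat \<Rightarrow> real" where
  "bratio m k = real (2 * m choose (m + k)) / real (2 * m choose m)"

lemma bratio_0 [simp]: "bratio m 0 = 1"
  by (simp add: bratio_def)

lemma bratio_Suc: "bratio m (Suc k) = bratio m k * (real (m - k) / real (m + k + 1))"
  unfolding bratio_def binomial_ratio_Suc by simp

lemma bratio_nonneg: "0 \<le> bratio m k"
  by (simp add: bratio_def)

text \<open>Each recursion factor is 1 - (2k+1)/(m+k+1), at most exp(-(2k+1)/(m+K)). The common
  denominator lets the exponents add up, and the first k odd numbers sum to k^2.\<close>

lemma bratio_le:
  assumes "k \<le> K"
  shows "bratio m k \<le> exp (- (real k)\<^sup>2 / real (m + K))"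
  using assms
proof (induction k)
  case (Suc k)
  have "real (m - k) / real (m + k + 1) \<le> exp (- real (2 * k + 1) / real (m + K))"
  proof (cases "k < m")
    case True
    have "real (m - k) / real (m + k + 1) = 1 + (- real (2 * k + 1) / real (m + k + 1))"
      using True by (simp add: field_simps of_nat_diff)
    also have "\<dots> \<le> exp (- real (2 * k + 1) / real (m + k + 1))"
      by (rule exp_ge_add_one_self)
    also have "\<dots> \<le> exp (- real (2 * k + 1) / real (m + K))"
      using Suc.prems True
      by (simp add: frac_le del: of_nat_add of_nat_mult of_nat_Suc flip: minus_divide_left)
    finally show ?thesis .
  qed simp
  then have "bratio m (Suc k) \<le> exp (- (real k)\<^sup>2 / real (m + K)) * exp (- real (2 * k + 1) / real (m + K))"
    unfolding bratio_Suc using Suc bratio_nonneg by (intro mult_mono) auto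
  also have "\<dots> = exp (- (real (Suc k))\<^sup>2 / real (m + K))"
    by (simp add: power2_eq_square algebra_simps add_divide_distrib diff_divide_distrib flip: exp_add)
  finally show ?case .
qed simp

text \<open>The same telescoping from below: the reciprocal of a recursion factor is 1 +
  (2k+1)/(m-k), at most exp((2k+1)/(m-K)). The condition K < m keeps the denominators
  positive.\<close>

lemma bratio_ge:
  assumes "k \<le> K" "K < m"
  shows "exp (- (real k)\<^sup>2 / real (m - K)) \<le> bratio m k"
  using assms(1)
proof (induction k)
  case (Suc k)
  have km: "k < m" using Suc.prems assms by simp
  have "exp (- real (2 * k + 1) / real (m - K)) \<le> exp (- real (2 * k + 1) / real (m - k))"
    using Suc.prems assms
    by (simp add: frac_le del: of_nat_add of_nat_mult of_nat_Suc of_nat_diff flip: minus_divide_left)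
  also have "\<dots> = inverse (exp (real (2 * k + 1) / real (m - k)))"
    by (metis exp_minus minus_divide_left)
  also have "\<dots> \<le> inverse (1 + real (2 * k + 1) / real (m - k))"
    using exp_ge_add_one_self[of "real (2 * k + 1) / real (m - k)"]
    by (intro le_imp_inverse_le) (auto intro: add_pos_nonneg)
  also have "\<dots> = real (m - k) / real (m + k + 1)"
    using km by (simp add: field_simps of_nat_diff)
  finally have "exp (- (real k)\<^sup>2 / real (m - K)) * exp (- real (2 * k + 1) / real (m - K)) \<le> bratio m (Suc k)"
    unfolding bratio_Suc using Suc bratio_nonneg by (intro mult_mono) auto
  moreover have "exp (- (real k)\<^sup>2 / real (m - K)) * exp (- real (2 * k + 1) / real (m - K)) =
      exp (- (real (Suc k))\<^sup>2 / real (m - K))"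
    by (simp add: power2_eq_square algebra_simps add_divide_distrib diff_divide_distrib flip: exp_add)
  ultimately show ?case by simp
qed simp

section \<open>Asymptotics of the central binomial coefficient\<close>

lemma central_binomial_gbinomial:
  "((- 1 / 2 :: real) gchoose m) = (- 1) ^ m * real (2 * m choose m) / 4 ^ m"
proof (induction m)
  case (Suc m)
  \<comment> \<open>The quotient of consecutive central coefficients, read off from (2m)! = m! m!
    (2m choose m); it matches the recursion of the generalized coefficient at -1/2.\<close>
  have "(2 * Suc m choose Suc m) * (Suc m * Suc m) = (2 * m choose m) * (2 * Suc m * (2 * m + 1))"
  proof -
    have "fact (Suc m) * fact (Suc m) * (2 * Suc m choose Suc m) = (fact (2 * Suc m) :: nat)"
      by (metis binomial_fact_lemma add_diff_cancel_right' le_add2 mult_2)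
    also have "\<dots> = 2 * Suc m * (2 * m + 1) * fact (2 * m)"
      by (simp add: algebra_simps)
    also have "fact (2 * m) = fact m * fact m * (2 * m choose m)"
      by (metis binomial_fact_lemma add_diff_cancel_right' le_add2 mult_2)
    finally have "fact m * fact m * ((2 * Suc m choose Suc m) * (Suc m * Suc m)) =
        fact m * fact m * ((2 * m choose m) * (2 * Suc m * (2 * m + 1)))"
      by (simp only: fact_Suc of_nat_id mult_ac)
    then show ?thesis by (metis fact_nonzero mult_eq_0_iff mult_left_cancel)
  qed
  then have eq0: "real (2 * Suc m choose Suc m) * (real (Suc m) * real (Suc m)) =
      real (2 * m choose m) * (2 * real (Suc m) * (2 * real m + 1))"
    by (metis (no_types, opaque_lifting) of_nat_mult of_nat_add of_nat_numeral of_nat_1)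
  then have eq: "real (2 * Suc m choose Suc m) * real (Suc m) = real (2 * m choose m) * (2 * (2 * real m + 1))"
  proof -
    have "X * q = B * (2 * r)" if "X * (q * q) = B * (2 * q * r)" "q \<noteq> 0" for X q B r :: real
      using that by (simp add: mult_ac)
    then show ?thesis using eq0 of_nat_neq_0 by blast
  qed
  have eq': "real (2 * Suc m choose Suc m) = real (2 * m choose m) * (2 * (2 * real m + 1)) / real (Suc m)"
    unfolding eq[symmetric] by (simp del: binomial_Suc_Suc of_nat_Suc)
  have "((- 1 / 2 :: real) gchoose Suc m) = (- 1 / 2 gchoose m) * (- 1 / 2 - real m) / real (Suc m)"
    using gbinomial_mult_1[of "- 1 / 2 :: real" m] by (simp add: field_simps)
  also have "\<dots> = (- 1) ^ Suc m * real (2 * Suc m choose Suc m) / 4 ^ Suc m"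
    unfolding Suc.IH eq' by (simp add: field_simps del: of_nat_Suc)
  finally show ?case .
qed simp

text \<open>Up to the sign and the power of 4, the central coefficient is -1/2 choose m, whose
  asymptotics involve 1 / Gamma(1/2). This is where sqrt pi enters.\<close>

lemma central_binomial_asymptotic:
  "(\<lambda>m. sqrt (real m) * real (2 * m choose m) / 4 ^ m) \<longlonglongrightarrow> 1 / sqrt pi"
proof -
  have "(\<lambda>n. ((- 1 / 2 :: real) gchoose n) / ((-1)^n / exp ((- 1 / 2 + 1) * of_real (ln (real n))))) \<longlonglongrightarrow>
      inverse (Gamma (- (- 1 / 2)))"
    by (rule gbinomial_asymptotic)
  then have "(\<lambda>n. ((- 1 / 2 :: real) gchoose n) / ((-1)^n / exp (ln (real n) / 2))) \<longlonglongrightarrow> 1 / sqrt pi"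
    by (simp add: Gamma_one_half_real inverse_eq_divide)
  moreover have "eventually (\<lambda>n. ((- 1 / 2 :: real) gchoose n) / ((-1)^n / exp (ln (real n) / 2)) =
      sqrt (real n) * real (2 * n choose n) / 4 ^ n) sequentially"
    using eventually_gt_at_top[of 0]
  proof eventually_elim
    case (elim n)
    have "exp (ln (real n) / 2) = sqrt (real n)"
      using elim by (simp add: ln_sqrt[symmetric])
    then show ?case
      unfolding central_binomial_gbinomial by (simp add: field_simps flip: power_mult_distrib)
  qed
  ultimately show ?thesis
    by (rule Lim_transform_eventually)
qed

subsection \<open>Jacobi's functional equation\<close>

lemma summable_theta: "0 < y \<Longrightarrow> summable (\<lambda>k. exp (- pi * (real (Suc k))\<^sup>2 * y))"
proof (rule summable_comparison_test')
  assume y: "0 < y"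
  show "summable (\<lambda>k. exp (- pi * y) ^ k)"
    using y by (intro summable_geometric) simp
  fix k :: nat
  have "exp (- pi * (real (Suc k))\<^sup>2 * y) \<le> exp (real k * (- pi * y))"
  proof -
    have "real k \<le> (real (Suc k))\<^sup>2" by (simp add: power2_eq_square algebra_simps)
    then have "real k * (pi * y) \<le> (real (Suc k))\<^sup>2 * (pi * y)"
      using y by (intro mult_right_mono) auto
    then show ?thesis
      by (simp only: exp_le_cancel_iff mult_minus_left mult_minus_right neg_le_iff_le mult_ac)
  qed
  then show "norm (exp (- pi * (real (Suc k))\<^sup>2 * y)) \<le> exp (- pi * y) ^ k"
    by (simp only: exp_of_nat_mult real_norm_def abs_exp_cancel)
qed

text \<open>The integers split into 0, the positive and the negative ones, and evenness of the terms
  makes the last two sums equal. The one-sided series suits Tannery's theorem and termwise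
  estimates.\<close>

lemma theta_eq_suminf:
  assumes "0 < y"
  shows "theta y = 1 + 2 * (\<Sum>k. exp (- pi * (real (Suc k))\<^sup>2 * y))"
proof -
  let ?f = "\<lambda>n::int. exp (- pi * (of_int n)\<^sup>2 * y)"
  let ?S = "\<Sum>k. exp (- pi * (real (Suc k))\<^sup>2 * y)"
  have hs: "((\<lambda>k. exp (- pi * (real (Suc k))\<^sup>2 * y)) has_sum ?S) UNIV"
    by (rule norm_summable_imp_has_sum)
       (use summable_theta[OF assms] in \<open>auto simp: summable_sums\<close>)
  have pos: "(?f has_sum ?S) (range (\<lambda>k. int (Suc k)))"
    using hs by (subst has_sum_reindex) (auto simp: inj_on_def o_def)
  have "?f \<circ> uminus = ?f" by (simp add: o_def)
  then have "(?f has_sum ?S) (uminus ` range (\<lambda>k. int (Suc k)))"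
    using pos by (subst has_sum_reindex) (auto simp: inj_on_def)
  then have neg: "(?f has_sum ?S) (range (\<lambda>k. - int (Suc k)))"
    by (simp only: image_image)
  have "(?f has_sum (?f 0)) {0}"
    using has_sum_finite[of "{0}" ?f] by simp
  from has_sum_Un_disjoint[OF this pos]
  have 1: "(?f has_sum (1 + ?S)) ({0} \<union> range (\<lambda>k. int (Suc k)))"
    by (simp add: image_iff)
  have "(?f has_sum (1 + ?S + ?S)) ({0} \<union> range (\<lambda>k. int (Suc k)) \<union> range (\<lambda>k. - int (Suc k)))"
    by (rule has_sum_Un_disjoint[OF 1 neg]) auto
  also have "{0} \<union> range (\<lambda>k. int (Suc k)) \<union> range (\<lambda>k. - int (Suc k)) = UNIV"
  proof -
    have "n \<in> {0} \<union> range (\<lambda>k. int (Suc k)) \<union> range (\<lambda>k. - int (Suc k))" for n :: int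
    proof (cases n rule: int_cases3)
      case (pos m) then show ?thesis by (auto intro!: image_eqI[of _ _ "m - 1"])
    next
      case (neg m) then show ?thesis by (auto intro!: image_eqI[of _ _ "m - 1"])
    qed simp
    then show ?thesis by blast
  qed
  finally show ?thesis
    unfolding theta_def by (simp add: infsumI)
qed

section \<open>Limits and majorants for the terms of Polya's identity\<close>

lemma sin_ge_half: "0 \<le> x \<Longrightarrow> x \<le> pi / 3 \<Longrightarrow> x / 2 \<le> sin (x::real)"
proof -
  assume x: "0 \<le> x" "x \<le> pi / 3"
  have "(\<lambda>t. sin t - t / 2) 0 \<le> (\<lambda>t. sin t - t / 2) x"
  proof (rule DERIV_nonneg_imp_nondecreasing[where f = "\<lambda>t. sin t - t / 2"])
    fix t :: real assume t: "0 \<le> t" "t \<le> x"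
    have "cos (pi / 3) \<le> cos t"
      using t x by (intro cos_monotone_0_pi_le) auto
    then show "\<exists>d. ((\<lambda>t. sin t - t / 2) has_real_derivative d) (at t) \<and> 0 \<le> d"
      by (intro exI[of _ "cos t - 1 / 2"]) (auto intro!: derivative_eq_intros simp: cos_60)
  qed (use x in auto)
  then show ?thesis by simp
qed

text \<open>From cos x = 1 - 2 sin(x/2)^2 and sin(x/2) >= x/4. It supplies a summable majorant for
  the cosine powers.\<close>

lemma cos_le_gauss:
  assumes "0 \<le> x" "x \<le> pi / 2"
  shows "cos x \<le> exp (- x\<^sup>2 / 8)"
proof -
  have "x / 2 / 2 \<le> sin (x / 2)"
    using assms by (intro sin_ge_half) auto
  then have "(x / 2 / 2)\<^sup>2 \<le> (sin (x / 2))\<^sup>2"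
    using assms by (intro power_mono) auto
  then have "cos x \<le> 1 + (- x\<^sup>2 / 8)"
    using cos_double_sin[of "x / 2"] by (simp add: power2_eq_square)
  also have "\<dots> \<le> exp (- x\<^sup>2 / 8)" by (rule exp_ge_add_one_self)
  finally show ?thesis .
qed

text \<open>Rounding down costs less than 1, hence less than 1/n^2 after division. It also keeps the
  quotient below its limit, which gives a bound uniform in n for the binomial side.\<close>

lemma theta_scaling_limit:
  assumes y: "0 < y"
  defines "m \<equiv> \<lambda>n. nat \<lfloor>(real n)\<^sup>2 * y / pi\<rfloor>"
  shows "(\<lambda>n. real (m n) / (real n)\<^sup>2) \<longlonglongrightarrow> y / pi"
    and "n > 0 \<Longrightarrow> real (m n) / (real n)\<^sup>2 \<le> y / pi"
proof -
  have le: "real (m n) \<le> (real n)\<^sup>2 * y / pi" for n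
    using y by (simp add: m_def)
  have ge: "(real n)\<^sup>2 * y / pi - 1 \<le> real (m n)" for n
    using y unfolding m_def by linarith
  show up: "n > 0 \<Longrightarrow> real (m n) / (real n)\<^sup>2 \<le> y / pi" for n
    using le[of n] by (simp add: divide_le_eq mult_ac)
  show "(\<lambda>n. real (m n) / (real n)\<^sup>2) \<longlonglongrightarrow> y / pi"
  proof (rule real_tendsto_sandwich)
    show "eventually (\<lambda>n. y / pi - 1 / (real n)\<^sup>2 \<le> real (m n) / (real n)\<^sup>2) sequentially"
      using eventually_gt_at_top[of 0]
    proof eventually_elim
      case (elim n)
      have "y / pi - 1 / (real n)\<^sup>2 = ((real n)\<^sup>2 * y / pi - 1) / (real n)\<^sup>2"
        using elim by (simp add: diff_divide_distrib)
      also have "\<dots> \<le> real (m n) / (real n)\<^sup>2"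
        by (intro divide_right_mono ge) simp
      finally show ?case .
    qed
    show "eventually (\<lambda>n. real (m n) / (real n)\<^sup>2 \<le> y / pi) sequentially"
      using eventually_gt_at_top[of 0] by eventually_elim (rule up)
    show "(\<lambda>n. y / pi - 1 / (real n)\<^sup>2) \<longlonglongrightarrow> y / pi" by real_asymp
  qed simp
qed

text \<open>Dominated convergence for series, in the form used below: the majorant holds for all k
  simultaneously once n is large, which yields the bound along the product filter in
  \<open>tannerys_theorem\<close>.\<close>

lemma tannery_nat:
  fixes a :: "nat \<Rightarrow> nat \<Rightarrow> real"
  assumes "\<And>k. (\<lambda>n. a n k) \<longlonglongrightarrow> b k" "summable M"
    and "eventually (\<lambda>n. \<forall>k. norm (a n k) \<le> M k) sequentially"
  shows "(\<lambda>n. \<Sum>k. a n k) \<longlonglongrightarrow> (\<Sum>k. b k)"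
proof -
  have "eventually (\<lambda>(k, n). norm (a n k) \<le> M k) (at_top \<times>\<^sub>F sequentially)"
    using eventually_prodI[OF always_eventually[of "\<lambda>k. True"] assms(3)]
    by (rule eventually_mono) auto
  then show ?thesis
    using tannerys_theorem[of "\<lambda>k n. a n k" b sequentially M] assms(1,2) by simp
qed

text \<open>With a = pi * l, 2 n^2 ln(cos(a/n)) tends to -a^2; the logarithm of the power is this
  quantity times m/n^2.\<close>

lemma cos_power_limit:
  fixes m :: "nat \<Rightarrow> nat"
  assumes "(\<lambda>n. real (m n) / (real n)\<^sup>2) \<longlonglongrightarrow> c"
  shows "(\<lambda>n. cos (pi * real l / real n) ^ (2 * m n)) \<longlonglongrightarrow> exp (- (pi * real l)\<^sup>2 * c)"
proof -
  define a where "a = pi * real l"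
  have "(\<lambda>n. 2 * (real n)\<^sup>2 * ln (cos (a / real n))) \<longlonglongrightarrow> - a\<^sup>2"
    by (cases "a = 0") (simp, real_asymp simp: power2_eq_square)
  from tendsto_exp[OF tendsto_mult[OF this assms]]
  have "(\<lambda>n. exp (2 * (real n)\<^sup>2 * ln (cos (a / real n)) * (real (m n) / (real n)\<^sup>2))) \<longlonglongrightarrow> exp (- a\<^sup>2 * c)" .
  moreover have "eventually (\<lambda>n. cos (a / real n) > 0) sequentially"
    by real_asymp
  then have "eventually (\<lambda>n. exp (2 * (real n)\<^sup>2 * ln (cos (a / real n)) * (real (m n) / (real n)\<^sup>2)) =
      cos (a / real n) ^ (2 * m n)) sequentially"
    using eventually_gt_at_top[of 0]
  proof eventually_elim
    case (elim n)
    have "exp (2 * (real n)\<^sup>2 * ln (cos (a / real n)) * (real (m n) / (real n)\<^sup>2)) =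
        exp (real (2 * m n) * ln (cos (a / real n)))"
      using elim by simp
    also have "\<dots> = cos (a / real n) ^ (2 * m n)"
      using elim by (simp only: exp_of_nat_mult exp_ln)
    finally show ?case .
  qed
  ultimately show ?thesis
    unfolding a_def by (rule Lim_transform_eventually)
qed

text \<open>Both Gaussian bounds are taken with k = K = n * j. Their exponents -(nj)^2 / (m
  \<plusminus> nj) equal -j^2 / (m/n^2 \<plusminus> j/n), and j/n tends to 0.\<close>

lemma bratio_limit:
  fixes m :: "nat \<Rightarrow> nat"
  assumes m: "(\<lambda>n. real (m n) / (real n)\<^sup>2) \<longlonglongrightarrow> c" and c: "c > 0"
  shows "(\<lambda>n. bratio (m n) (n * j)) \<longlonglongrightarrow> exp (- (real j)\<^sup>2 / c)"
proof (rule real_tendsto_sandwich)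
  let ?q = "\<lambda>n. real (m n) / (real n)\<^sup>2"
  have z: "(\<lambda>n. real j / real n) \<longlonglongrightarrow> 0" by real_asymp
  have lim: "(\<lambda>n. exp (- (real j)\<^sup>2 / (?q n - real j / real n))) \<longlonglongrightarrow> exp (- (real j)\<^sup>2 / (c - 0))"
    by (intro tendsto_intros m z) (use c in auto)
  then show "(\<lambda>n. exp (- (real j)\<^sup>2 / (?q n - real j / real n))) \<longlonglongrightarrow> exp (- (real j)\<^sup>2 / c)" by simp
  have "(\<lambda>n. exp (- (real j)\<^sup>2 / (?q n + real j / real n))) \<longlonglongrightarrow> exp (- (real j)\<^sup>2 / (c + 0))"
    by (intro tendsto_intros m z) (use c in auto)
  then show "(\<lambda>n. exp (- (real j)\<^sup>2 / (?q n + real j / real n))) \<longlonglongrightarrow> exp (- (real j)\<^sup>2 / c)" by simp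
  have "eventually (\<lambda>n. ?q n - real j / real n > 0) sequentially"
    using tendsto_diff[OF m z] c by (intro order_tendstoD(1)) auto
  then show "eventually (\<lambda>n. exp (- (real j)\<^sup>2 / (?q n - real j / real n)) \<le> bratio (m n) (n * j)) sequentially"
    using eventually_gt_at_top[of 0]
  proof eventually_elim
    case (elim n)
    have eq: "?q n - real j / real n = (real (m n) - real (n * j)) / (real n)\<^sup>2"
      using elim by (simp add: field_simps power2_eq_square)
    then have less: "n * j < m n"
      using elim by (simp add: zero_less_divide_iff flip: of_nat_mult)
    have "- (real j)\<^sup>2 / (?q n - real j / real n) = - (real (n * j))\<^sup>2 / real (m n - n * j)"
      unfolding eq using less elim by (simp add: of_nat_diff power_mult_distrib field_simps)
    then show ?case using bratio_ge[OF order_refl less] by simp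
  qed
  show "eventually (\<lambda>n. bratio (m n) (n * j) \<le> exp (- (real j)\<^sup>2 / (?q n + real j / real n))) sequentially"
    using eventually_gt_at_top[of 0]
  proof eventually_elim
    case (elim n)
    have eq: "?q n + real j / real n = real (m n + n * j) / (real n)\<^sup>2"
      using elim by (simp add: field_simps power2_eq_square)
    have "- (real j)\<^sup>2 / (?q n + real j / real n) = - (real (n * j))\<^sup>2 / real (m n + n * j)"
      unfolding eq using elim by (simp add: power_mult_distrib field_simps)
    then show ?case using bratio_le[OF order_refl, of "m n" "n * j"] by simp
  qed
qed

text \<open>Polya's identity along odd n with m/n^2 tending to y/pi: the cosine side tends to
  \<open>theta y\<close>, the sum of ratios to \<open>theta (1 / y)\<close>, and the prefactor
  \<open>A\<close> to 1 / sqrt y.\<close>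

lemma theta_functional_equation:
  assumes y: "0 < y"
  shows "theta y = theta (1 / y) / sqrt y"
proof -
  define m where "m = (\<lambda>n. nat \<lfloor>(real n)\<^sup>2 * y / pi\<rfloor>)"
  define N where "N = (\<lambda>p::nat. 2 * p + 1)"
  have N: "filterlim N sequentially sequentially"
    unfolding N_def by (rule filterlim_subseq) (auto simp: strict_mono_def)
  have Npos: "N p > 0" for p by (simp add: N_def)
  have limq: "(\<lambda>n. real (m n) / (real n)\<^sup>2) \<longlonglongrightarrow> y / pi"
    unfolding m_def by (rule theta_scaling_limit(1)[OF y])
  have leq: "n > 0 \<Longrightarrow> real (m n) / (real n)\<^sup>2 \<le> y / pi" for n
    unfolding m_def by (rule theta_scaling_limit(2)[OF y])
  have c: "y / pi > 0" using y by simp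
  define a where "a = (\<lambda>p k. if Suc k \<le> p then cos (pi * real (Suc k) / real (N p)) ^ (2 * m (N p)) else 0)"
  define b where "b = (\<lambda>p k. bratio (m (N p)) (N p * Suc k))"
  define A where "A = (\<lambda>p. real (N p) * real (2 * m (N p) choose m (N p)) / 4 ^ m (N p))"

  have geom: "summable (\<lambda>k. exp (- d) ^ Suc k)" if "d > 0" for d :: real
    using that by (subst summable_Suc_iff) (auto intro: summable_geometric)

  have lim_a: "(\<lambda>p. \<Sum>k. a p k) \<longlonglongrightarrow> (\<Sum>k. exp (- pi * (real (Suc k))\<^sup>2 * y))"
  proof (rule tannery_nat)
    fix k
    have "(\<lambda>p. cos (pi * real (Suc k) / real (N p)) ^ (2 * m (N p))) \<longlonglongrightarrow> exp (- (pi * real (Suc k))\<^sup>2 * (y / pi))"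
      using filterlim_compose[OF cos_power_limit[OF limq] N] .
    also have "- (pi * real (Suc k))\<^sup>2 * (y / pi) = - pi * (real (Suc k))\<^sup>2 * y"
      by (simp add: power2_eq_square)
    finally show "(\<lambda>p. a p k) \<longlonglongrightarrow> exp (- pi * (real (Suc k))\<^sup>2 * y)"
      by (rule Lim_transform_eventually)
         (use eventually_ge_at_top[of "Suc k"] in eventually_elim, simp add: a_def)
    \<comment> \<open>For x = pi k / n, exp(-x^2/8)^(2m) has exponent -(pi k)^2/4 * (m/n^2).
      Eventually m/n^2 > y/(2 pi), and k^2 >= k; this yields pi * y / 8 per unit of k.\<close>
    show "summable (\<lambda>k. exp (- (pi * y / 8)) ^ Suc k)"
      using y by (intro geom) simp
    have "eventually (\<lambda>n. real (m n) / (real n)\<^sup>2 > y / pi / 2) sequentially"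
      using c by (intro order_tendstoD(1)[OF limq]) simp
    then have "eventually (\<lambda>p. real (m (N p)) / (real (N p))\<^sup>2 > y / pi / 2) sequentially"
      by (rule eventually_compose_filterlim[OF _ N])
    then show "eventually (\<lambda>p. \<forall>k. norm (a p k) \<le> exp (- (pi * y / 8)) ^ Suc k) sequentially"
    proof eventually_elim
      case (elim p)
      show ?case
      proof
        fix k
        show "norm (a p k) \<le> exp (- (pi * y / 8)) ^ Suc k"
        proof (cases "Suc k \<le> p")
          case True
          let ?x = "pi * real (Suc k) / real (N p)"
          have "2 * Suc k \<le> N p"
            using True by (simp add: N_def)
          then have "real (2 * Suc k) \<le> real (N p)"
            by (simp only: of_nat_le_iff)
          then have x: "0 \<le> ?x" "?x \<le> pi / 2"
            using Npos[of p] by (auto simp: divide_le_eq)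
          have cos: "0 \<le> cos ?x"
            using x by (intro cos_ge_zero) linarith+
          have "cos ?x ^ (2 * m (N p)) \<le> exp (- ?x\<^sup>2 / 8) ^ (2 * m (N p))"
            using x cos by (intro power_mono cos_le_gauss) auto
          also have "\<dots> = exp (- ((pi * real (Suc k))\<^sup>2 / 4 * (real (m (N p)) / (real (N p))\<^sup>2)))"
            by (simp add: power_divide field_simps flip: exp_of_nat_mult)
          also have "\<dots> \<le> exp (- ((pi * real (Suc k))\<^sup>2 / 4 * (y / pi / 2)))"
            using elim by (simp only: exp_le_cancel_iff neg_le_iff_le) (intro mult_left_mono, auto)
          also have "\<dots> = exp (- ((real (Suc k))\<^sup>2 * (pi * y / 8)))"
            by (simp add: power2_eq_square)
          also have "\<dots> \<le> exp (- (real (Suc k) * (pi * y / 8)))"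
            using y self_le_power[of "real (Suc k)" 2]
            by (simp only: exp_le_cancel_iff neg_le_iff_le) (intro mult_right_mono, auto)
          also have "\<dots> = exp (- (pi * y / 8)) ^ Suc k"
            by (simp only: exp_of_nat_mult[symmetric] mult_minus_right)
          finally show ?thesis using True cos by (simp add: a_def)
        qed (simp add: a_def)
      qed
    qed
  qed

  have lim_b: "(\<lambda>p. \<Sum>k. b p k) \<longlonglongrightarrow> (\<Sum>k. exp (- pi * (real (Suc k))\<^sup>2 * (1 / y)))"
  proof (rule tannery_nat)
    fix k
    show "(\<lambda>p. b p k) \<longlonglongrightarrow> exp (- pi * (real (Suc k))\<^sup>2 * (1 / y))"
      using filterlim_compose[OF bratio_limit[OF limq c] N, of "Suc k"]
      by (simp add: b_def mult_ac)
    \<comment> \<open>While n k <= m, \<open>bratio_le\<close> with K = m gives the exponent -(nk)^2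
      / (2m); now m <= (y/pi) n^2 and k^2 >= k produce the rate pi / (2y). For n k > m the term is
      0.\<close>
    show "summable (\<lambda>k. exp (- (pi / (2 * y))) ^ Suc k)"
      using y by (intro geom) simp
    have "norm (b p k) \<le> exp (- (pi / (2 * y))) ^ Suc k" for p k
    proof (cases "N p * Suc k \<le> m (N p)")
      case True
      then have m0: "m (N p) > 0" using Npos[of p]
        by (metis gr0I le_zero_eq mult_eq_0_iff nat.distinct(1))
      have "b p k \<le> exp (- (real (N p * Suc k))\<^sup>2 / real (m (N p) + m (N p)))"
        unfolding b_def by (rule bratio_le[OF True])
      also have "\<dots> \<le> exp (- (real (Suc k) * (pi / (2 * y))))"
      proof -
        have "real (m (N p)) \<le> (y / pi) * (real (N p))\<^sup>2"
          using leq[OF Npos[of p]] Npos[of p] by (simp add: divide_le_eq)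
        then have "real (Suc k) * (pi / (2 * y)) * real (m (N p) + m (N p)) \<le>
            real (Suc k) * (pi / (2 * y)) * (2 * ((y / pi) * (real (N p))\<^sup>2))"
          using y by (intro mult_left_mono) auto
        also have "\<dots> = real (Suc k) * (real (N p))\<^sup>2"
          using y by simp
        also have "\<dots> \<le> (real (Suc k))\<^sup>2 * (real (N p))\<^sup>2"
          using self_le_power[of "real (Suc k)" 2] by (intro mult_right_mono) auto
        also have "\<dots> = (real (N p * Suc k))\<^sup>2"
          by (simp only: of_nat_mult power_mult_distrib mult.commute)
        finally have "real (Suc k) * (pi / (2 * y)) \<le> (real (N p * Suc k))\<^sup>2 / real (m (N p) + m (N p))"
          using m0 by (subst pos_le_divide_eq) auto
        then show ?thesis by simp
      qed
      also have "\<dots> = exp (- (pi / (2 * y))) ^ Suc k"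
        by (simp only: exp_of_nat_mult[symmetric] mult_minus_right)
      finally show ?thesis by (simp add: b_def bratio_nonneg)
    next
      case False
      then have "2 * m (N p) choose (m (N p) + N p * Suc k) = 0"
        by (intro binomial_eq_0) linarith
      then have "b p k = 0"
        unfolding b_def bratio_def by (simp only: of_nat_0 div_0)
      then show ?thesis by simp
    qed
    then show "eventually (\<lambda>p. \<forall>k. norm (b p k) \<le> exp (- (pi / (2 * y))) ^ Suc k) sequentially"
      by simp
  qed

  \<comment> \<open>Write n as sqrt m / sqrt(m/n^2): the central asymptotics give 1 / sqrt pi, and
    dividing by the limit sqrt(y/pi) leaves 1 / sqrt y.\<close>
  have lim_A: "A \<longlonglongrightarrow> 1 / sqrt y"
  proof -
    have pos: "eventually (\<lambda>p. real (m (N p)) / (real (N p))\<^sup>2 > 0) sequentially"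
      using order_tendstoD(1)[OF filterlim_compose[OF limq N] c] .
    have "filterlim (\<lambda>p. real (m (N p))) at_top sequentially"
    proof (rule filterlim_cong[THEN iffD1, OF refl refl])
      show "filterlim (\<lambda>p. real (m (N p)) / (real (N p))\<^sup>2 * (real (N p))\<^sup>2) at_top sequentially"
        by (rule filterlim_tendsto_pos_mult_at_top[OF filterlim_compose[OF limq N] c])
           (unfold N_def, real_asymp)
    qed (simp add: N_def)
    then have mtop: "filterlim (\<lambda>p. m (N p)) sequentially sequentially"
      by (simp add: filterlim_sequentially_iff_filterlim_real)
    have "(\<lambda>p. sqrt (real (m (N p))) * real (2 * m (N p) choose m (N p)) / 4 ^ m (N p) /
        sqrt (real (m (N p)) / (real (N p))\<^sup>2)) \<longlonglongrightarrow> 1 / sqrt pi / sqrt (y / pi)"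
      using c by (intro tendsto_divide tendsto_real_sqrt filterlim_compose[OF limq N]
        filterlim_compose[OF central_binomial_asymptotic mtop]) auto
    moreover have "1 / sqrt pi / sqrt (y / pi) = 1 / sqrt y"
      by (simp add: real_sqrt_divide)
    moreover have "eventually (\<lambda>p. sqrt (real (m (N p))) * real (2 * m (N p) choose m (N p)) / 4 ^ m (N p) /
        sqrt (real (m (N p)) / (real (N p))\<^sup>2) = A p) sequentially"
      using pos
    proof eventually_elim
      case (elim p)
      then have "m (N p) > 0" by (auto intro: gr0I)
      then show ?case using Npos[of p]
        by (simp add: A_def real_sqrt_divide field_simps)
    qed
    ultimately show ?thesis by (auto intro: Lim_transform_eventually)
  qed

  have eq: "1 + 2 * (\<Sum>k. a p k) = A p * (1 + 2 * (\<Sum>k. b p k))" for p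
  proof -
    have "(\<Sum>k. a p k) = (\<Sum>k<p. a p k)"
      by (rule suminf_finite) (auto simp: a_def)
    also have "\<dots> = (\<Sum>l\<in>{1..p}. cos (pi * real l / real (N p)) ^ (2 * m (N p)))"
      unfolding a_def
      by (rule sum.reindex_bij_witness[of _ "\<lambda>l. l - 1" Suc]) auto
    finally have 1: "(\<Sum>k. a p k) = (\<Sum>l\<in>{1..p}. cos (pi * real l / real (N p)) ^ (2 * m (N p)))" .
    have "b p k = 0" if "k \<ge> m (N p)" for k
    proof -
      have "N p * Suc k \<ge> Suc k" using Npos[of p] by (cases "N p") auto
      then have "N p * Suc k > m (N p)" using that by simp
      then show ?thesis by (simp add: b_def bratio_def)
    qed
    then have "(\<Sum>k. b p k) = (\<Sum>k<m (N p). b p k)"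
      by (intro suminf_finite) (auto simp: not_less)
    also have "\<dots> = (\<Sum>j\<in>{1..m (N p)}. real (2 * m (N p) choose (m (N p) + N p * j)) / real (2 * m (N p) choose m (N p)))"
      unfolding b_def bratio_def
      by (rule sum.reindex_bij_witness[of _ "\<lambda>l. l - 1" Suc]) auto
    finally have 2: "(\<Sum>k. b p k) = \<dots>" .
    show ?thesis
      unfolding 1 2 A_def by (rule polya_identity) (simp add: N_def)
  qed
  have "(\<lambda>p. 1 + 2 * (\<Sum>k. a p k)) \<longlonglongrightarrow> theta y"
    unfolding theta_eq_suminf[OF y] by (intro tendsto_intros lim_a)
  moreover have "(\<lambda>p. A p * (1 + 2 * (\<Sum>k. b p k))) \<longlonglongrightarrow> 1 / sqrt y * theta (1 / y)"
    unfolding theta_eq_suminf[OF divide_pos_pos[OF zero_less_one y]]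
    by (intro tendsto_intros lim_A lim_b)
  ultimately show ?thesis
    unfolding eq using LIMSEQ_unique by fastforce
qed

subsection \<open>Entire functions of two variables\<close>

text \<open>A remainder of order |h|^2 on the unit ball is o(|h|). Such a bound, unlike a mere
  limit, can be integrated over a parameter.\<close>

lemma has_derivative_quadratic_remainder:
  fixes f :: "'a::real_normed_vector \<Rightarrow> 'b::real_normed_vector"
  assumes "bounded_linear D"
    and rem: "\<And>h. norm h \<le> 1 \<Longrightarrow> norm (f (z + h) - f z - D h) \<le> C * (norm h)\<^sup>2"
  shows "(f has_derivative D) (at z)"
  unfolding has_derivative_at
proof (intro conjI assms(1))
  show "(\<lambda>h. norm (f (z + h) - f z - D h) / norm h) \<midarrow>0\<rightarrow> 0"
  proof (rule tendsto_sandwich)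
    show "eventually (\<lambda>h. 0 \<le> norm (f (z + h) - f z - D h) / norm h) (at 0)" by simp
    have "eventually (\<lambda>h::'a. dist h 0 < 1) (at 0)"
      by (auto simp: eventually_at intro!: exI[of _ 1])
    then show "eventually (\<lambda>h. norm (f (z + h) - f z - D h) / norm h \<le> C * norm h) (at 0)"
      using eventually_neq_at_within[of 0]
    proof eventually_elim
      case (elim h)
      then show ?case
        using rem[of h] by (simp add: divide_le_eq power2_eq_square mult.assoc)
    qed
    show "((\<lambda>h. C * norm h) \<longlongrightarrow> 0) (at (0::'a))"
      by (auto intro!: tendsto_eq_intros)
  qed simp
qed

lemma self_le_exp: "x \<le> exp (x::real)"
  using exp_ge_add_one_self[of x] by linarith

lemma exp_remainder2:
  fixes u v :: complex
  shows "norm (exp (u + v) - exp u - v * exp u) \<le> exp (norm u + norm v) * (norm v)\<^sup>2"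
proof -
  have "norm (exp v - (\<Sum>i\<le>1. v ^ i / fact i)) \<le> exp (norm v) * norm v ^ Suc 1 / fact 1"
    by (rule Taylor_exp_field)
  then have "norm (exp v - 1 - v) \<le> exp (norm v) * (norm v)\<^sup>2"
    by (simp add: algebra_simps numeral_2_eq_2)
  then have "norm (exp u) * norm (exp v - 1 - v) \<le> exp (norm u) * (exp (norm v) * (norm v)\<^sup>2)"
    by (intro mult_mono norm_exp) auto
  moreover have "exp (u + v) - exp u - v * exp u = exp u * (exp v - 1 - v)"
    by (simp add: exp_add algebra_simps)
  ultimately show ?thesis by (simp add: norm_mult exp_add mult.assoc)
qed

text \<open>Differentiation under the integral sign: the exponential moments of every order dominate
  the integrand, the first-order terms and the quadratic Taylor remainder.\<close>

lemma entire2_double_laplace: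
  fixes a b :: "'a \<Rightarrow> real"
  assumes [measurable]: "a \<in> borel_measurable M" "b \<in> borel_measurable M"
    and int: "\<And>r. integrable M (\<lambda>x. exp (r * (\<bar>a x\<bar> + \<bar>b x\<bar>)))"
  shows "entire2 (\<lambda>(w, s). \<integral>x. exp (w * complex_of_real (a x) + s * complex_of_real (b x)) \<partial>M)"
    and "integrable M (\<lambda>x. exp (w * complex_of_real (a x) + s * complex_of_real (b x)))"
proof -
  let ?c = "\<lambda>x. \<bar>a x\<bar> + \<bar>b x\<bar>"
  let ?e = "\<lambda>z x. fst z * complex_of_real (a x) + snd z * complex_of_real (b x)"
  have e_le: "norm (?e z x) \<le> norm z * ?c x" for z x
  proof -
    have "norm (?e z x) \<le> norm (fst z) * \<bar>a x\<bar> + norm (snd z) * \<bar>b x\<bar>"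
      by (rule order_trans[OF norm_triangle_ineq]) (simp add: norm_mult)
    also have "\<dots> \<le> norm z * \<bar>a x\<bar> + norm z * \<bar>b x\<bar>"
      using norm_fst_le[of "fst z" "snd z"] norm_snd_le[of "snd z" "fst z"]
      by (intro add_mono mult_right_mono) auto
    finally show ?thesis by (simp add: algebra_simps)
  qed
  have exp_le: "norm (exp (?e z x)) \<le> exp (norm z * ?c x)" for z x
    by (rule order_trans[OF norm_exp]) (use e_le in simp)
  have int0: "integrable M (\<lambda>x. exp (?e z x))" for z
    by (rule Bochner_Integration.integrable_bound[OF int[of "norm z"]]) (use exp_le in auto)
  have int1: "integrable M (\<lambda>x. g x * exp (?e z x))"
    if [measurable]: "g \<in> borel_measurable M" and g: "\<And>x. norm (g x) \<le> ?c x" for g z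
  proof (rule Bochner_Integration.integrable_bound[OF int[of "norm z + 1"]])
    have "norm (g x * exp (?e z x)) \<le> norm (exp ((norm z + 1) * ?c x))" for x
    proof -
      have "norm (g x) * norm (exp (?e z x)) \<le> exp (?c x) * exp (norm z * ?c x)"
        using g[of x] self_le_exp[of "?c x"] by (intro mult_mono exp_le) auto
      then show ?thesis by (simp add: norm_mult algebra_simps flip: exp_add)
    qed
    then show "AE x in M. norm (g x * exp (?e z x)) \<le> norm (exp ((norm z + 1) * ?c x))" by simp
  qed simp
  show "integrable M (\<lambda>x. exp (w * complex_of_real (a x) + s * complex_of_real (b x)))"
    using int0[of "(w, s)"] by simp
  define F where "F = (\<lambda>z. \<integral>x. exp (?e z x) \<partial>M)"
  have "\<exists>A B. (F has_derivative (\<lambda>(h, k). A * h + B * k)) (at z)" for z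
  proof -
    define A where "A = (\<integral>x. complex_of_real (a x) * exp (?e z x) \<partial>M)"
    define B where "B = (\<integral>x. complex_of_real (b x) * exp (?e z x) \<partial>M)"
    have intA: "integrable M (\<lambda>x. complex_of_real (a x) * exp (?e z x))"
      by (rule int1) auto
    have intB: "integrable M (\<lambda>x. complex_of_real (b x) * exp (?e z x))"
      by (rule int1) auto
    have "(F has_derivative (\<lambda>h. A * fst h + B * snd h)) (at z)"
    proof (rule has_derivative_quadratic_remainder)
      show "bounded_linear (\<lambda>h. A * fst h + B * snd h)"
        by (intro bounded_linear_intros)
      fix h :: "complex \<times> complex" assume h: "norm h \<le> 1"
      have D: "A * fst h + B * snd h = (\<integral>x. ?e h x * exp (?e z x) \<partial>M)"
      proof -
        have "A * fst h + B * snd h = (\<integral>x. fst h * (a x * exp (?e z x)) + snd h * (b x * exp (?e z x)) \<partial>M)"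
          unfolding A_def B_def using intA intB by (simp add: mult.commute)
        then show ?thesis by (simp add: algebra_simps)
      qed
      have intD: "integrable M (\<lambda>x. ?e h x * exp (?e z x))"
      proof -
        have "integrable M (\<lambda>x. fst h * (a x * exp (?e z x)) + snd h * (b x * exp (?e z x)))"
          using intA intB by simp
        then show ?thesis by (simp add: algebra_simps)
      qed
      have add: "?e (z + h) x = ?e z x + ?e h x" for x
        by (simp add: algebra_simps)
      have "F (z + h) - F z - (A * fst h + B * snd h) =
          (\<integral>x. exp (?e (z + h) x) - exp (?e z x) - ?e h x * exp (?e z x) \<partial>M)"
        unfolding D F_def using int0 intD by (simp only: Bochner_Integration.integral_diff Bochner_Integration.integrable_diff)
      \<comment> \<open>Of the extra 3 in the exponent, one comes from the increment with norm h <=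
        1, and two from the squared linear factor via \<open>?c x \<le> exp (?c x)\<close>.\<close>
      also have "norm \<dots> \<le> (\<integral>x. (norm h)\<^sup>2 * exp ((norm z + 3) * ?c x) \<partial>M)"
      proof (rule order_trans[OF Bochner_Integration.integral_norm_bound], rule Bochner_Integration.integral_mono)
        fix x
        have "norm (exp (?e (z + h) x) - exp (?e z x) - ?e h x * exp (?e z x))
            \<le> exp (norm (?e z x) + norm (?e h x)) * (norm (?e h x))\<^sup>2"
          unfolding add by (rule exp_remainder2)
        also have "\<dots> \<le> exp (norm z * ?c x + ?c x) * (norm h * exp (?c x))\<^sup>2"
        proof (intro mult_mono power_mono)
          have "norm h * ?c x \<le> ?c x"
            using h by (intro mult_left_le_one_le) auto
          then show "exp (norm (?e z x) + norm (?e h x)) \<le> exp (norm z * ?c x + ?c x)"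
            using e_le[of z x] e_le[of h x] by simp
          show "norm (?e h x) \<le> norm h * exp (?c x)"
            by (rule order_trans[OF e_le]) (intro mult_left_mono self_le_exp, simp)
        qed auto
        also have "\<dots> = (norm h)\<^sup>2 * exp ((norm z + 3) * ?c x)"
          by (simp add: power2_eq_square algebra_simps flip: exp_add)
        finally show "norm (exp (?e (z + h) x) - exp (?e z x) - ?e h x * exp (?e z x))
            \<le> (norm h)\<^sup>2 * exp ((norm z + 3) * ?c x)" .
      qed (use int0 intD int in auto)
      finally show "norm (F (z + h) - F z - (A * fst h + B * snd h)) \<le>
          (\<integral>x. exp ((norm z + 3) * ?c x) \<partial>M) * (norm h)\<^sup>2"
        by (simp add: mult.commute)
    qed
    then show ?thesis by (auto simp: case_prod_beta')
  qed
  moreover have "(\<lambda>(w, s). \<integral>x. exp (w * complex_of_real (a x) + s * complex_of_real (b x)) \<partial>M) = F"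
    by (auto simp: F_def fun_eq_iff)
  ultimately show "entire2 (\<lambda>(w, s). \<integral>x. exp (w * complex_of_real (a x) + s * complex_of_real (b x)) \<partial>M)"
    unfolding entire2_def by simp
qed

lemma entire2_const: "entire2 (\<lambda>_. c)"
  unfolding entire2_def by (auto intro!: exI[of _ 0] derivative_eq_intros)

lemma entire2_linear: "entire2 (\<lambda>(w, s). a * w + b * s)"
proof -
  have "bounded_linear (\<lambda>z::complex \<times> complex. a * fst z + b * snd z)"
    by (intro bounded_linear_intros)
  then show ?thesis
    unfolding entire2_def case_prod_beta' by (blast intro: bounded_linear_imp_has_derivative)
qed

lemma entire2_add:
  assumes "entire2 F" "entire2 G"
  shows "entire2 (\<lambda>z. F z + G z)"
  unfolding entire2_def
proof
  fix z
  obtain a b c d where "(F has_derivative (\<lambda>(h, k). a * h + b * k)) (at z)"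
      "(G has_derivative (\<lambda>(h, k). c * h + d * k)) (at z)"
    using assms unfolding entire2_def by metis
  from has_derivative_add[OF this]
  have "((\<lambda>z. F z + G z) has_derivative (\<lambda>(h, k). (a + c) * h + (b + d) * k)) (at z)"
    by (simp add: case_prod_beta' algebra_simps)
  then show "\<exists>a b. ((\<lambda>z. F z + G z) has_derivative (\<lambda>(h, k). a * h + b * k)) (at z)" by blast
qed

lemma entire2_mult:
  assumes "entire2 F" "entire2 G"
  shows "entire2 (\<lambda>z. F z * G z)"
  unfolding entire2_def
proof
  fix z
  obtain a b c d where "(F has_derivative (\<lambda>(h, k). a * h + b * k)) (at z)"
      "(G has_derivative (\<lambda>(h, k). c * h + d * k)) (at z)"
    using assms unfolding entire2_def by metis
  from has_derivative_mult[OF this]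
  have "((\<lambda>z. F z * G z) has_derivative
      (\<lambda>(h, k). (F z * c + a * G z) * h + (F z * d + b * G z) * k)) (at z)"
    by (simp add: case_prod_beta' algebra_simps)
  then show "\<exists>a b. ((\<lambda>z. F z * G z) has_derivative (\<lambda>(h, k). a * h + b * k)) (at z)" by blast
qed

lemma entire2_reflect:
  assumes "entire2 F"
  shows "entire2 (\<lambda>(w, s). F (w, w - s))"
  unfolding entire2_def
proof
  fix z :: "complex \<times> complex"
  have bl: "bounded_linear (\<lambda>z::complex \<times> complex. (fst z, fst z - snd z))"
    by (intro bounded_linear_intros)
  obtain a b where "(F has_derivative (\<lambda>(h, k). a * h + b * k)) (at (fst z, fst z - snd z))"
    using assms unfolding entire2_def by blast
  from has_derivative_compose[OF bounded_linear_imp_has_derivative[OF bl] this]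
  have "((\<lambda>(w, s). F (w, w - s)) has_derivative (\<lambda>(h, k). (a + b) * h + (- b) * k)) (at z)"
    by (simp add: case_prod_beta' algebra_simps)
  then show "\<exists>a b. ((\<lambda>(w, s). F (w, w - s)) has_derivative (\<lambda>(h, k). a * h + b * k)) (at z)"
    by blast
qed

subsection \<open>The logarithm of the theta function\<close>

text \<open>The function \<open>L\<close> of the overview. The factor 2 reflects that
  \<open>Z_Q\<close> evaluates \<open>theta\<close> at t^2, with t = exp x.\<close>

definition log_theta :: "real \<Rightarrow> real" where
  "log_theta x = ln (theta (exp (2 * x)))"

lemma theta_gt_1: "0 < y \<Longrightarrow> 1 < theta y"
  by (subst theta_eq_suminf) (auto intro!: suminf_pos simp del: of_nat_Suc simp: summable_theta[simplified])

lemma theta_antimono: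
  assumes "0 < y" "y \<le> z"
  shows "theta z \<le> theta y"
proof -
  have "(\<Sum>k. exp (- pi * (real (Suc k))\<^sup>2 * z)) \<le> (\<Sum>k. exp (- pi * (real (Suc k))\<^sup>2 * y))"
  proof (rule suminf_le)
    fix k
    have "(pi * (real (Suc k))\<^sup>2) * y \<le> (pi * (real (Suc k))\<^sup>2) * z"
      using assms by (intro mult_left_mono) auto
    then show "exp (- pi * (real (Suc k))\<^sup>2 * z) \<le> exp (- pi * (real (Suc k))\<^sup>2 * y)"
      by (simp only: exp_le_cancel_iff mult_minus_left neg_le_iff_le)
  qed ((rule summable_theta, insert assms, simp)+)
  then show ?thesis using assms by (simp add: theta_eq_suminf)
qed

text \<open>Every rate pi k^2 with k >= 1 is at least 1, so passing from 1 to y shrinks each term of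
  the series by at least exp(1 - y).\<close>

lemma theta_decay:
  assumes "1 \<le> y"
  shows "theta y - 1 \<le> (theta 1 - 1) * exp (1 - y)"
proof -
  have "(\<Sum>k. exp (- pi * (real (Suc k))\<^sup>2 * y)) \<le> (\<Sum>k. exp (- pi * (real (Suc k))\<^sup>2 * 1) * exp (1 - y))"
  proof (rule suminf_le)
    fix k
    have "1 * 1 \<le> pi * (real (Suc k))\<^sup>2"
      using pi_gt3 by (intro mult_mono one_le_power) auto
    then have "1 * (y - 1) \<le> pi * (real (Suc k))\<^sup>2 * (y - 1)"
      using assms by (intro mult_right_mono) auto
    then have "- pi * (real (Suc k))\<^sup>2 * y \<le> - pi * (real (Suc k))\<^sup>2 * 1 + (1 - y)"
      by (simp only: right_diff_distrib mult_minus_left mult_1_left mult_1_right)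
    then show "exp (- pi * (real (Suc k))\<^sup>2 * y) \<le> exp (- pi * (real (Suc k))\<^sup>2 * 1) * exp (1 - y)"
      by (simp only: exp_le_cancel_iff flip: exp_add)
  qed ((intro summable_theta summable_mult2, insert assms, simp)+)
  also have "\<dots> = (\<Sum>k. exp (- pi * (real (Suc k))\<^sup>2 * 1)) * exp (1 - y)"
    by (intro suminf_mult2[symmetric] summable_theta) simp
  finally show ?thesis using assms by (simp add: theta_eq_suminf)
qed

lemma log_theta_pos: "0 < log_theta x"
  unfolding log_theta_def by (intro ln_gt_zero theta_gt_1) simp

lemma log_theta_antimono: "x \<le> y \<Longrightarrow> log_theta y \<le> log_theta x"
  unfolding log_theta_def
  using theta_antimono[of "exp (2 * x)" "exp (2 * y)"] theta_gt_1[of "exp (2 * y)"] by simp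

lemma log_theta_measurable [measurable]: "log_theta \<in> borel_measurable borel"
proof -
  have "(\<lambda>x. - log_theta x) \<in> borel_measurable borel"
    by (intro borel_measurable_mono monoI) (simp add: log_theta_antimono)
  then show ?thesis by simp
qed

text \<open>Jacobi's equation at y = exp(-2x), where the factor 1 / sqrt y is exp x and the
  logarithm turns it into the summand x.\<close>

lemma log_theta_uminus: "log_theta (- x) = x + log_theta x"
proof -
  have "exp (- (2 * x)) = (exp (- x))\<^sup>2"
    by (simp add: power2_eq_square flip: exp_add)
  then have sq: "sqrt (exp (2 * (- x))) = exp (- x)" by simp
  have "theta (exp (2 * (- x))) = exp x * theta (exp (2 * x))"
    using theta_functional_equation[of "exp (2 * (- x))"] unfolding sq by (simp add: exp_minus field_simps)
  then show ?thesis
    unfolding log_theta_def using theta_gt_1[of "exp (2 * x)"] by (simp add: ln_mult_pos)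
qed

text \<open>From ln u <= u - 1 the decay is even like exp(-exp(2x)). The quadratic Taylor bound
  weakens it to a Gaussian, which still beats every exp(r x).\<close>

lemma log_theta_le_gauss:
  assumes "0 \<le> x"
  shows "log_theta x \<le> (theta 1 - 1) * exp (- 2 * x\<^sup>2)"
proof -
  have "1 + 2 * x + (2 * x)\<^sup>2 / 2 \<le> exp (2 * x)"
    using assms by (intro exp_lower_Taylor_quadratic) simp
  then have "1 - exp (2 * x) \<le> - 2 * x\<^sup>2"
    using assms by (simp add: power_mult_distrib)
  then have e: "exp (1 - exp (2 * x)) \<le> exp (- 2 * x\<^sup>2)" by simp
  have "log_theta x \<le> theta (exp (2 * x)) - 1"
    unfolding log_theta_def using theta_gt_1[of "exp (2 * x)"] by (intro ln_le_minus_one) simp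
  also have "\<dots> \<le> (theta 1 - 1) * exp (1 - exp (2 * x))"
    using assms by (intro theta_decay) simp
  also have "\<dots> \<le> (theta 1 - 1) * exp (- 2 * x\<^sup>2)"
    using theta_gt_1[of 1] by (intro mult_left_mono e) auto
  finally show ?thesis .
qed

subsection \<open>The integral as a Laplace transform\<close>

text \<open>This integral is the source of the poles. Integrability is settled first, through the
  modulus exp(Re s * x), because the complex fundamental theorem on an unbounded interval
  presupposes it.\<close>

lemma set_integral_exp_Ioi:
  assumes "Re s < 0"
  shows "set_integrable lborel {0<..} (\<lambda>x. exp (s * complex_of_real x))"
    and "(LBINT x:{0<..}. exp (s * complex_of_real x)) = - 1 / s"
proof -
  have s0: "s \<noteq> 0" using assms by auto
  have lim: "((\<lambda>x. exp (c * x)) \<longlongrightarrow> 0) at_top" if "c < 0" for c :: real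
    using that by real_asymp
  have real_int: "set_integrable lborel (einterval 0 \<infinity>) (\<lambda>x. exp (Re s * x))"
  proof (rule interval_integral_FTC_nonneg)
    show "((\<lambda>x. exp (Re s * x) / Re s) has_real_derivative exp (Re s * x)) (at x)" for x
      using assms by (auto intro!: derivative_eq_intros)
    have "((\<lambda>x. exp (Re s * x) / Re s) \<longlongrightarrow> exp (Re s * 0) / Re s) (at_right 0)"
      using assms by (intro tendsto_intros) auto
    then show "(((\<lambda>x. exp (Re s * x) / Re s) \<circ> real_of_ereal) \<longlongrightarrow> exp (Re s * 0) / Re s) (at_right 0)"
      by (simp add: zero_ereal_def ereal_tendsto_simps1)
    show "(((\<lambda>x. exp (Re s * x) / Re s) \<circ> real_of_ereal) \<longlongrightarrow> 0 / Re s) (at_left \<infinity>)"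
      unfolding ereal_tendsto_simps1 using assms by (intro tendsto_divide lim) auto
  qed auto
  have ei: "einterval 0 \<infinity> = {0<..}" by (auto simp: einterval_def)
  show int: "set_integrable lborel {0<..} (\<lambda>x. exp (s * complex_of_real x))"
    by (rule set_integrable_bound[OF real_int[unfolded ei]])
       (auto simp: set_borel_measurable_def)
  have "(LBINT x=0..\<infinity>. exp (s * complex_of_real x)) = 0 - exp (s * complex_of_real 0) / s"
  proof (rule interval_integral_FTC_integrable)
    show "((\<lambda>x. exp (s * complex_of_real x) / s) has_vector_derivative exp (s * complex_of_real x)) (at x)" for x
      using s0 by (auto intro!: derivative_eq_intros has_vector_derivative_real_field)
    have "((\<lambda>x. exp (s * complex_of_real x) / s) \<longlongrightarrow> exp (s * complex_of_real 0) / s) (at_right 0)"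
      using s0 by (intro tendsto_intros)
    then show "(((\<lambda>x. exp (s * complex_of_real x) / s) \<circ> real_of_ereal) \<longlongrightarrow> exp (s * complex_of_real 0) / s) (at_right 0)"
      by (simp add: zero_ereal_def ereal_tendsto_simps1)
    have "((\<lambda>x. norm (exp (s * complex_of_real x) / s)) \<longlongrightarrow> 0) at_top"
      using tendsto_divide[OF lim[OF assms] tendsto_const[of "norm s"]] s0 by (simp add: norm_divide)
    then show "(((\<lambda>x. exp (s * complex_of_real x) / s) \<circ> real_of_ereal) \<longlongrightarrow> 0) (at_left \<infinity>)"
      unfolding ereal_tendsto_simps1 by (rule tendsto_norm_zero_cancel)
  qed (use int ei in \<open>auto intro!: continuous_intros\<close>)
  then show "(LBINT x:{0<..}. exp (s * complex_of_real x)) = - 1 / s"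
    by (simp add: interval_lebesgue_integral_def ei)
qed

lemma integral_exp_interval:
  assumes "0 < l" "w \<noteq> 0"
  shows "(LBINT u:{0<..<l}. exp (w * complex_of_real u)) = (exp (w * l) - 1) / w"
proof -
  have "(LBINT u=ereal 0..ereal l. exp (w * complex_of_real u)) = exp (w * complex_of_real l) / w - exp (w * complex_of_real 0) / w"
    using assms
    by (intro interval_integral_FTC_finite)
       (auto intro!: continuous_intros derivative_eq_intros has_vector_derivative_real_field)
  then show ?thesis
    using assms by (simp add: interval_lebesgue_integral_def einterval_eq diff_divide_distrib)
qed

text \<open>The domain of the double Laplace transform. The first coordinate x is dual to s, the
  second coordinate u to w.\<close>

definition under_log_theta :: "(real \<times> real) set" where
  "under_log_theta = {(x, u). 0 < x \<and> 0 < u \<and> u < log_theta x}"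

lemma under_log_theta_measurable [measurable]: "under_log_theta \<in> sets (lborel \<Otimes>\<^sub>M lborel)"
proof -
  have "under_log_theta = {p \<in> space (lborel \<Otimes>\<^sub>M lborel). 0 < fst p \<and> 0 < snd p \<and> snd p < log_theta (fst p)}"
    by (auto simp: under_log_theta_def space_pair_measure)
  also have "\<dots> \<in> sets (lborel \<Otimes>\<^sub>M lborel)" by measurable
  finally show ?thesis .
qed

lemma under_log_theta_Int_space: "under_log_theta \<inter> space (lborel \<Otimes>\<^sub>M lborel) \<in> sets (lborel \<Otimes>\<^sub>M lborel)"
  by (intro sets.Int under_log_theta_measurable sets.top)

lemma indicator_under_log_theta:
  "indicator under_log_theta (x, u) = (indicator {0<..} x * indicator {0<..<log_theta x} u :: real)"
  by (auto simp: under_log_theta_def indicator_def)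

lemma log_theta_exp_integrable:
  "integrable lborel (\<lambda>x. indicator {0<..} x * (log_theta x * exp (r * (log_theta x + x))))"
proof -
  \<comment> \<open>The maximum of (r+1)x - 2x^2 is (r+1)^2 / 8, so the Gaussian absorbs exp(r x)
    and leaves the integrable factor exp(-x); r * \<open>log_theta x\<close> is bounded by |r| times
    the value at 0.\<close>
  define K where "K = (theta 1 - 1) * exp (\<bar>r\<bar> * log_theta 0 + (r + 1)\<^sup>2 / 8)"
  have K: "0 \<le> K" using theta_gt_1[of 1] by (simp add: K_def)
  have "set_integrable lborel {0<..} (\<lambda>x. exp (- 1 * complex_of_real x))"
    by (rule set_integral_exp_Ioi) simp
  from set_integrable_norm[OF this]
  have "integrable lborel (\<lambda>x::real. indicator {0<..} x * exp (- x))"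
    by (simp add: set_integrable_def)
  then have "integrable lborel (\<lambda>x. K * (indicator {0<..} x * exp (- x)))" by simp
  then show ?thesis
  proof (rule Bochner_Integration.integrable_bound)
    have "log_theta x * exp (r * (log_theta x + x)) \<le> K * exp (- x)" if x: "0 < x" for x
    proof -
      have "r * log_theta x \<le> \<bar>r\<bar> * log_theta 0"
        using x log_theta_pos[of x] by (intro mult_mono log_theta_antimono) auto
      moreover have "r * x - 2 * x\<^sup>2 \<le> (r + 1)\<^sup>2 / 8 - x"
        using zero_le_power2[of "4 * x - (r + 1)"] by (simp add: power2_eq_square algebra_simps)
      ultimately have le: "- 2 * x\<^sup>2 + r * (log_theta x + x) \<le> \<bar>r\<bar> * log_theta 0 + (r + 1)\<^sup>2 / 8 + - x"
        by (simp add: algebra_simps)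
      have "log_theta x * exp (r * (log_theta x + x)) \<le>
          (theta 1 - 1) * exp (- 2 * x\<^sup>2) * exp (r * (log_theta x + x))"
        using x by (intro mult_right_mono log_theta_le_gauss) auto
      also have "\<dots> = (theta 1 - 1) * exp (- 2 * x\<^sup>2 + r * (log_theta x + x))"
        by (simp only: exp_add mult.assoc)
      also have "\<dots> \<le> (theta 1 - 1) * exp (\<bar>r\<bar> * log_theta 0 + (r + 1)\<^sup>2 / 8 + - x)"
        using theta_gt_1[of 1] le by (intro mult_left_mono) auto
      also have "\<dots> = K * exp (- x)" by (simp only: K_def exp_add mult.assoc)
      finally show ?thesis .
    qed
    then show "AE x in lborel. norm (indicator {0<..} x * (log_theta x * exp (r * (log_theta x + x))))
        \<le> norm (K * (indicator {0<..} x * exp (- x)))"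
      using K log_theta_pos by (auto simp: indicator_def abs_mult less_imp_le)
  qed measurable
qed

text \<open>The moment condition of \<open>entire2_double_laplace\<close>. By Fubini it reduces to
  one variable: over x lies an interval of length \<open>log_theta x\<close> on which the integrand
  is at most exp(|r| (\<open>log_theta x\<close> + x)).\<close>

lemma under_log_theta_exp_integrable:
  "integrable (restrict_space (lborel \<Otimes>\<^sub>M lborel) under_log_theta) (\<lambda>p. exp (r * (\<bar>snd p\<bar> + \<bar>fst p\<bar>)))"
proof -
  let ?f = "\<lambda>p. indicator under_log_theta p * exp (r * (\<bar>snd p\<bar> + \<bar>fst p\<bar>))"
  have bound: "exp (r * (\<bar>u\<bar> + \<bar>x\<bar>)) \<le> exp (\<bar>r\<bar> * (log_theta x + x))" if "0 < x" "0 < u" "u < log_theta x" for x u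
  proof -
    have "r * (\<bar>u\<bar> + \<bar>x\<bar>) \<le> \<bar>r\<bar> * (log_theta x + x)"
      using that by (intro mult_mono) auto
    then show ?thesis by simp
  qed
  have inner: "integrable lborel (\<lambda>u. ?f (x, u))" for x
  proof (rule Bochner_Integration.integrable_bound)
    show "integrable lborel (\<lambda>u. indicator {0<..<log_theta x} u * exp (\<bar>r\<bar> * (log_theta x + x)))"
      using log_theta_pos[of x] by simp
    show "AE u in lborel. norm (?f (x, u)) \<le> norm (indicator {0<..<log_theta x} u * exp (\<bar>r\<bar> * (log_theta x + x)))"
      using bound[of x] by (intro AE_I2) (auto simp: indicator_under_log_theta split: split_indicator)
  qed (simp add: indicator_under_log_theta)
  have "integrable (lborel \<Otimes>\<^sub>M lborel) ?f"
  proof (rule lborel_pair.Fubini_integrable)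
    show "integrable lborel (\<lambda>x. \<integral>u. norm (?f (x, u)) \<partial>lborel)"
    proof (rule Bochner_Integration.integrable_bound[OF log_theta_exp_integrable[of "\<bar>r\<bar>"]])
      have "(\<integral>u. norm (?f (x, u)) \<partial>lborel) \<le> indicator {0<..} x * (log_theta x * exp (\<bar>r\<bar> * (log_theta x + x)))" for x
      proof -
        have "(\<integral>u. norm (?f (x, u)) \<partial>lborel) \<le>
            (\<integral>u. indicator {0<..} x * exp (\<bar>r\<bar> * (log_theta x + x)) * indicator {0<..<log_theta x} u \<partial>lborel)"
        proof (rule Bochner_Integration.integral_mono[OF integrable_norm[OF inner]])
          have "emeasure lborel {0<..<log_theta x} < \<infinity>"
            using log_theta_pos[of x] by simp
          then show "integrable lborel (\<lambda>u. indicator {0<..} x * exp (\<bar>r\<bar> * (log_theta x + x)) * indicator {0<..<log_theta x} u)"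
            by (intro integrable_mult_right integrable_real_indicator) auto
          show "norm (?f (x, u)) \<le> indicator {0<..} x * exp (\<bar>r\<bar> * (log_theta x + x)) * indicator {0<..<log_theta x} u" for u
            using bound[of x u] by (simp add: indicator_under_log_theta split: split_indicator)
        qed
        also have "\<dots> = indicator {0<..} x * (log_theta x * exp (\<bar>r\<bar> * (log_theta x + x)))"
          using log_theta_pos[of x] by simp
        finally show ?thesis .
      qed
      then show "AE x in lborel. norm (\<integral>u. norm (?f (x, u)) \<partial>lborel) \<le>
          norm (indicator {0<..} x * (log_theta x * exp (\<bar>r\<bar> * (log_theta x + x))))"
        by (intro AE_I2) (smt (verit) Bochner_Integration.integral_nonneg norm_ge_zero real_norm_def)
    qed measurable
  qed (use inner in auto)
  then show ?thesis
    by (simp add: integrable_restrict_space[OF under_log_theta_Int_space])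
qed

definition theta_transform :: "complex \<Rightarrow> complex \<Rightarrow> complex" where
  "theta_transform w s = (\<integral>p. exp (w * complex_of_real (snd p) + s * complex_of_real (fst p))
     \<partial>restrict_space (lborel \<Otimes>\<^sub>M lborel) under_log_theta)"

lemma entire2_theta_transform: "entire2 (\<lambda>(w, s). theta_transform w s)"
  unfolding theta_transform_def
  by (rule entire2_double_laplace) (auto intro: under_log_theta_exp_integrable measurable_restrict_space1)

text \<open>Fubini: the inner integral over u is (exp(w \<open>log_theta x\<close>) - 1) / w, so
  multiplying by w recovers the one-variable integral.\<close>

lemma mult_theta_transform:
  assumes "w \<noteq> 0"
  shows "set_integrable lborel {0<..} (\<lambda>x. exp (s * complex_of_real x) * (exp (w * complex_of_real (log_theta x)) - 1))"
    and "(LBINT x:{0<..}. exp (s * complex_of_real x) * (exp (w * complex_of_real (log_theta x)) - 1)) = w * theta_transform w s"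
proof -
  let ?e = "\<lambda>p. exp (w * complex_of_real (snd p) + s * complex_of_real (fst p))"
  let ?g = "\<lambda>x. exp (s * complex_of_real x) * (exp (w * complex_of_real (log_theta x)) - 1)"
  have "integrable (restrict_space (lborel \<Otimes>\<^sub>M lborel) under_log_theta) ?e"
    by (rule entire2_double_laplace) (auto intro: under_log_theta_exp_integrable measurable_restrict_space1)
  then have int: "integrable (lborel \<Otimes>\<^sub>M lborel) (\<lambda>p. indicator under_log_theta p *\<^sub>R ?e p)"
    by (simp only: integrable_restrict_space[OF under_log_theta_Int_space])
  have inner: "(\<integral>u. indicator under_log_theta (x, u) *\<^sub>R ?e (x, u) \<partial>lborel) = indicator {0<..} x *\<^sub>R (?g x / w)" for x
  proof -
    have "(\<integral>u. indicator under_log_theta (x, u) *\<^sub>R ?e (x, u) \<partial>lborel) =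
        (\<integral>u. (indicator {0<..} x *\<^sub>R exp (s * complex_of_real x)) *
          (indicator {0<..<log_theta x} u *\<^sub>R exp (w * complex_of_real u)) \<partial>lborel)"
      by (intro Bochner_Integration.integral_cong)
         (auto simp: indicator_under_log_theta exp_add scaleR_conv_of_real)
    also have "\<dots> = (indicator {0<..} x *\<^sub>R exp (s * complex_of_real x)) * (LBINT u:{0<..<log_theta x}. exp (w * complex_of_real u))"
      unfolding set_lebesgue_integral_def by (rule integral_mult_right_zero)
    also have "\<dots> = indicator {0<..} x *\<^sub>R (?g x / w)"
      using assms log_theta_pos[of x] by (simp add: integral_exp_interval scaleR_conv_of_real)
    finally show ?thesis .
  qed
  have cancel: "w * (indicator {0<..} x *\<^sub>R (?g x / w)) = indicator {0<..} x *\<^sub>R ?g x" for x :: real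
    using assms by (simp add: indicator_def)
  have "integrable lborel (\<lambda>x. indicator {0<..} x *\<^sub>R (?g x / w))"
    using lborel_pair.integrable_fst'[OF int] unfolding inner .
  then have "integrable lborel (\<lambda>x. w * (indicator {0<..} x *\<^sub>R (?g x / w)))"
    by (rule integrable_mult_right)
  then show "set_integrable lborel {0<..} ?g"
    unfolding cancel set_integrable_def .
  have "theta_transform w s = (\<integral>x. indicator {0<..} x *\<^sub>R (?g x / w) \<partial>lborel)"
    using lborel_pair.integral_fst'[OF int] unfolding inner theta_transform_def
    by (simp only: integral_restrict_space[OF under_log_theta_Int_space])
  then have "w * theta_transform w s = (\<integral>x. w * (indicator {0<..} x *\<^sub>R (?g x / w)) \<partial>lborel)"
    by (simp only: integral_mult_right_zero)
  then show "(LBINT x:{0<..}. ?g x) = w * theta_transform w s"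
    unfolding cancel set_lebesgue_integral_def by (rule sym)
qed

section \<open>Evaluation of the integral \<open>Z_Q\<close>\<close>

lemma half_line_integral:
  assumes "w \<noteq> 0" "Re s < 0"
  shows "set_integrable lborel {0<..} (\<lambda>x. exp (w * complex_of_real (log_theta x) + s * complex_of_real x))"
    and "(LBINT x:{0<..}. exp (w * complex_of_real (log_theta x) + s * complex_of_real x)) = w * theta_transform w s - 1 / s"
proof -
  \<comment> \<open>Subtracting the limit 1 of exp(w \<open>log_theta x\<close>) isolates the only
    slowly decaying part, which integrates to -1/s.\<close>
  have eq: "exp (w * complex_of_real (log_theta x) + s * complex_of_real x) =
      exp (s * complex_of_real x) * (exp (w * complex_of_real (log_theta x)) - 1) + exp (s * complex_of_real x)" for x
    by (simp add: exp_add algebra_simps)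
  show "set_integrable lborel {0<..} (\<lambda>x. exp (w * complex_of_real (log_theta x) + s * complex_of_real x))"
    unfolding eq by (intro set_integral_add mult_theta_transform assms set_integral_exp_Ioi)
  show "(LBINT x:{0<..}. exp (w * complex_of_real (log_theta x) + s * complex_of_real x)) = w * theta_transform w s - 1 / s"
    unfolding eq using assms by (simp add: set_integral_add mult_theta_transform set_integral_exp_Ioi)
qed

text \<open>In the variable x = ln t the integrand is \<open>H\<close>. The half-line x > 0 has
  parameter w - s, and reflection by \<open>log_theta_uminus\<close> gives x < 0 the parameter s.
  The two inequalities say that both parameters have negative real part.\<close>

lemma Z_Q_eq_theta_transform:
  assumes "Re w < Re s" "Re s < 0"
  shows "Z_Q w s = w * (theta_transform w s + theta_transform w (w - s)) - 1 / s - 1 / (w - s)"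
proof -
  have w0: "w \<noteq> 0" using assms by auto
  define H where "H = (\<lambda>x. exp (w * complex_of_real (log_theta x) + (w - s) * complex_of_real x))"
  have H_neg: "H (- x) = exp (w * complex_of_real (log_theta x) + s * complex_of_real x)" for x
    by (simp add: H_def log_theta_uminus algebra_simps)
  have H_pos_int: "set_integrable lborel {0<..} H"
    and H_pos: "(LBINT x:{0<..}. H x) = w * theta_transform w (w - s) - 1 / (w - s)"
    unfolding H_def using assms w0 by (auto intro!: half_line_integral)
  have "set_integrable lborel {0<..} (\<lambda>x. H (- x))"
    unfolding H_neg using assms w0 by (intro half_line_integral)
  then have "integrable lborel (\<lambda>x. indicator {0<..} (0 + (- 1) * x) *\<^sub>R H (- (0 + (- 1) * x)))"
    unfolding set_integrable_def by (rule lborel_integrable_real_affine) simp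
  moreover have "indicator {0<..} (0 + (- 1) * x) = (indicator {..<0} x :: real)" for x :: real
    by (simp add: indicator_def)
  ultimately have H_neg_int: "set_integrable lborel {..<0} H"
    by (simp add: set_integrable_def)
  have "(LBINT x:{..<0}. H x) = (LBINT x:{0<..}. H (- x))"
    by (subst set_integral_reflect) (simp add: greaterThan_def)
  then have H_neg_val: "(LBINT x:{..<0}. H x) = w * theta_transform w s - 1 / s"
    unfolding H_neg using assms w0 by (simp add: half_line_integral)
  have un: "{..<0} \<union> {0<..} = (UNIV :: real set) - {0}" by auto
  have H_int: "set_integrable lborel (UNIV - {0}) H"
    unfolding un[symmetric] by (intro set_integrable_Un H_neg_int H_pos_int) auto
  have H_val: "(LBINT x:UNIV - {0}. H x) = w * theta_transform w s - 1 / s + (w * theta_transform w (w - s) - 1 / (w - s))"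
    unfolding un[symmetric] H_pos[symmetric] H_neg_val[symmetric]
    by (intro set_integral_Un H_neg_int H_pos_int) auto
  have AE: "AE x in lborel. indicator (UNIV - {0::real}) x *\<^sub>R H x = H x"
    using AE_lborel_singleton[of "0::real"] by eventually_elim (simp add: indicator_def)
  have H_meas: "H \<in> borel_measurable borel"
    unfolding H_def by measurable
  have H_int': "integrable lborel H"
    using H_int AE H_meas unfolding set_integrable_def
    by (subst (asm) integrable_cong_AE) auto
  have H_val': "integral\<^sup>L lborel H = w * theta_transform w s - 1 / s + (w * theta_transform w (w - s) - 1 / (w - s))"
    unfolding H_val[symmetric] set_lebesgue_integral_def
    using AE H_meas by (intro integral_cong_AE) auto
  define F where "F = (\<lambda>t. H (ln t) / complex_of_real t)"
  have F_meas: "set_borel_measurable borel {0<..} F"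
    unfolding F_def H_def set_borel_measurable_def by measurable
  have F_exp: "exp x *\<^sub>R F (exp x) = H x" for x
    by (simp add: F_def scaleR_conv_of_real)
  have rng: "range exp = {0::real<..}"
    by (auto simp: image_iff) (metis exp_ln)
  \<comment> \<open>The change of variables t = exp x is made for absolutely integrable functions
    over the completed measure. Borel measurability of \<open>H\<close> and \<open>F\<close> permits
    the passage there and back.\<close>
  have "H absolutely_integrable_on UNIV \<and> integral UNIV H = integral\<^sup>L lborel H"
  proof
    have "set_integrable lborel UNIV H" using H_int' by (simp add: set_integrable_def)
    then show "H absolutely_integrable_on UNIV"
      using H_meas by (simp add: set_integrable_def integrable_completion)
    show "integral UNIV H = integral\<^sup>L lborel H"
      using integral_unique[OF has_integral_integral_lborel[OF H_int']] .
  qed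
  then have "F absolutely_integrable_on range exp \<and> integral (range exp) F = integral\<^sup>L lborel H"
    by (subst has_absolute_integral_change_of_variables_real[where g = exp and h = exp, symmetric])
       (auto intro!: derivative_eq_intros simp: F_exp inj_on_def)
  then have F_abs: "F absolutely_integrable_on {0<..}" and F_val: "integral {0<..} F = integral\<^sup>L lborel H"
    unfolding rng by auto
  have "set_integrable lborel {0<..} F"
    using F_abs F_meas unfolding set_integrable_def set_borel_measurable_def
    by (subst (asm) integrable_completion) auto
  from set_borel_integral_eq_integral(2)[OF this]
  have F_lborel: "(LBINT t:{0<..}. F t) = integral\<^sup>L lborel H"
    using F_val by simp
  have "complex_of_real (theta (t\<^sup>2)) powr s * complex_of_real (theta (1 / t\<^sup>2)) powr (w - s) / complex_of_real t = F t"
    if t: "0 < t" for t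
  proof -
    have e1: "exp (2 * ln t) = t\<^sup>2" and e2: "exp (2 * (- ln t)) = 1 / t\<^sup>2"
      using t by (simp_all add: exp_double exp_minus inverse_eq_divide power_divide)
    have l1: "ln (theta (t\<^sup>2)) = log_theta (ln t)"
      unfolding log_theta_def e1 ..
    have "ln (theta (1 / t\<^sup>2)) = log_theta (- ln t)"
      unfolding log_theta_def e2 ..
    then have l2: "ln (theta (1 / t\<^sup>2)) = ln t + log_theta (ln t)"
      by (simp only: log_theta_uminus)
    have p: "theta (t\<^sup>2) > 0" "theta (1 / t\<^sup>2) > 0"
      using t theta_gt_1[of "t\<^sup>2"] theta_gt_1[of "1 / t\<^sup>2"] by auto
    have "complex_of_real (theta (t\<^sup>2)) powr s * complex_of_real (theta (1 / t\<^sup>2)) powr (w - s) =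
        exp (s * complex_of_real (log_theta (ln t)) + (w - s) * complex_of_real (ln t + log_theta (ln t)))"
      using p by (simp add: powr_def Ln_of_real l1 l2 exp_add)
    also have "\<dots> = H (ln t)"
      unfolding H_def by (simp add: algebra_simps)
    finally show ?thesis by (simp add: F_def)
  qed
  then have "Z_Q w s = (LBINT t:{0<..}. F t)"
    unfolding Z_Q_def by (intro set_lebesgue_integral_cong) auto
  then show ?thesis
    unfolding F_lborel H_val' by (simp add: algebra_simps)
qed

section \<open>The entire continuation and its symmetry\<close>

theorem theorem2p1:
  "\<exists>Xi :: complex \<times> complex \<Rightarrow> complex.
     entire2 Xi \<and>
     (\<forall>(w, s) \<in> xi_region. Xi (w, s) = xi_Q w s) \<and>
     (\<forall>w s. Xi (w, s) = Xi (w, w - s))"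
proof (intro exI conjI ballI allI)
  \<comment> \<open>The formula for \<open>Z_Q\<close> times s(s-w)/(2w): the poles -1/s - 1/(w-s) =
    w/(s(s-w)) become the constant 1/2, and the factor w cancels. Replacing s by w - s fixes s(s-w)
    and swaps the two transforms.\<close>
  define Xi where "Xi = (\<lambda>(w, s). 1 / 2 + s * (s - w) / 2 * (theta_transform w s + theta_transform w (w - s)))"
  \<comment> \<open>\<open>Xi\<close> is spelled out with explicit coefficients 0, 1 and -1 to fit
    the shape of \<open>entire2_linear\<close> and the closure rules.\<close>
  have "entire2 (\<lambda>z. 1 / 2 + (1 / 2 * ((case z of (w, s) \<Rightarrow> 0 * w + 1 * s) * (case z of (w, s) \<Rightarrow> - 1 * w + 1 * s))) *
      ((case z of (w, s) \<Rightarrow> theta_transform w s) + (case z of (w, s) \<Rightarrow> (case (w, w - s) of (w, s) \<Rightarrow> theta_transform w s))))"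
    by (intro entire2_add entire2_mult entire2_const entire2_linear entire2_theta_transform entire2_reflect[OF entire2_theta_transform])
  also have "(\<lambda>z. 1 / 2 + (1 / 2 * ((case z of (w, s) \<Rightarrow> 0 * w + 1 * s) * (case z of (w, s) \<Rightarrow> - 1 * w + 1 * s))) *
      ((case z of (w, s) \<Rightarrow> theta_transform w s) + (case z of (w, s) \<Rightarrow> (case (w, w - s) of (w, s) \<Rightarrow> theta_transform w s)))) = Xi"
    by (auto simp: Xi_def fun_eq_iff)
  finally show "entire2 Xi" .
  show "Xi (w, s) = Xi (w, w - s)" for w s
    by (simp add: Xi_def algebra_simps)
  fix z assume "z \<in> xi_region"
  then obtain w s where z: "z = (w, s)" and ws: "Re w < Re s" "Re s < 0"
    by (auto simp: xi_region_def)
  then have nz: "w \<noteq> 0" "s \<noteq> 0" "w - s \<noteq> 0" by auto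
  have "1 / s + 1 / (w - s) = - (w / (s * (s - w)))"
    using nz by (simp add: divide_simps) (simp add: algebra_simps)
  then have "xi_Q w s = s * (s - w) / (2 * w) * (w * (theta_transform w s + theta_transform w (w - s)) + w / (s * (s - w)))"
    unfolding xi_Q_def Z_Q_eq_theta_transform[OF ws] by (simp add: algebra_simps)
  also have "\<dots> = Xi (w, s)"
    using nz by (simp add: Xi_def divide_simps) (simp add: algebra_simps)
  finally show "case z of (w, s) \<Rightarrow> Xi (w, s) = xi_Q w s"
    by (simp add: z)
qed

end
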